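(* Let $\mathbb{F}$ be a finite field and let $G$ be a superregular $3\times3$ matrix over $\mathbb{F}$. If $A,B,C$ are $2\times2$ matrices over $\mathbb{F}$ such that $G=\tilde C\tilde B\tilde A$, then each of $A,B,C$ is superregular (i.e. all its entries and its determinant are nonzero).
   Context: A matrix over a field is superregular if all of its minors (of all sizes, including the entries and the full determinant) are nonzero; superregular $3\times 3$ and $2\times 2$ matrices represent linear perfect tensors with 6 and 4 legs respectively. For $2\times 2$ matrices $A=[a_{ij}]$, $B=[b_{ij}]$, $C=[c_{ij}]$ over $\mathbb{F}$, define $$\tilde A=\begin{bmatrix} a_{11} & a_{12} & 0 \\ a_{21} & a_{22} & 0 \\ 0 & 0 & 1 \end{bmatrix},\quad \tilde B=\begin{bmatrix} b_{11} & 0 & b_{12} \\ 0 & 1 & 0 \\ b_{21} & 0 & b_{22} \end{bmatrix},\quad \tilde C=\begin{bmatrix} 1 & 0 & 0 \\ 0 & c_{11} & c_{12} \\ 0 & c_{21} & c_{22} \end{bmatrix}.$$ *)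

theory Defs
  imports "Jordan_Normal_Form.Determinant" "Jordan_Normal_Form.DL_Submatrix"
begin

definition superregular :: "'a::field mat \<Rightarrow> bool" where
  "superregular M \<longleftrightarrow>
     (\<forall>I J. I \<subseteq> {..<dim_row M} \<and> J \<subseteq> {..<dim_col M} \<and> card I = card J \<and> I \<noteq> {}
        \<longrightarrow> det (submatrix M I J) \<noteq> 0)"

(* Matrix indices start at 0, so the (i,j) entry of the mathematics is M $$ (i-1, j-1). *)

definition tildeA :: "'a::field mat \<Rightarrow> 'a mat" where
  "tildeA A = mat_of_rows_list 3
     [[A $$ (0,0), A $$ (0,1), 0],
      [A $$ (1,0), A $$ (1,1), 0],
      [0,          0,          1]]"

definition tildeB :: "'a::field mat \<Rightarrow> 'a mat" where
  "tildeB B = mat_of_rows_list 3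
     [[B $$ (0,0), 0, B $$ (0,1)],
      [0,          1, 0         ],
      [B $$ (1,0), 0, B $$ (1,1)]]"

definition tildeC :: "'a::field mat \<Rightarrow> 'a mat" where
  "tildeC C = mat_of_rows_list 3
     [[1, 0,          0         ],
      [0, C $$ (0,0), C $$ (0,1)],
      [0, C $$ (1,0), C $$ (1,1)]]"

end

theory Submission
  imports Defs
begin

text \<open>
  The entries \<open>(0,0)\<close>, \<open>(0,1)\<close>, \<open>(0,2)\<close>, \<open>(1,2)\<close>, \<open>(2,2)\<close> of \<open>G\<close>, all its \<open>2 \<times> 2\<close> minors on the
  columns \<open>0, 1\<close>, the minors on the rows \<open>1, 2\<close>, and \<open>det G\<close> are, up to sign, products of entries
  and determinants of \<open>A\<close>, \<open>B\<close>, \<open>C\<close>; every entry and every determinant occurs as a factor.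
\<close>

text \<open>\<open>submatrix\<close> selects indices through \<open>pick\<close>, a recursion over
  least elements. On a pair it is evaluated once and for all here and in the next lemma, so that
  later proofs can drop \<open>pick.simps\<close> and never meet \<open>LEAST\<close>.\<close>

lemma pick_zero_pair:
  assumes "a < (b::nat)"
  shows "pick {a, b} 0 = a"
  using assms by (auto intro: Least_equality)

lemma pick_one_pair:
  assumes "a < (b::nat)"
  shows "pick {a, b} (Suc 0) = b"
  using assms by (auto simp: pick_zero_pair[simplified] intro!: Least_equality)

lemma det_2:
  assumes "M \<in> carrier_mat 2 2"
  shows "det M = M $$ (0,0) * M $$ (1,1) - M $$ (0,1) * M $$ (1,0)"
proof -
  have del: "mat_delete M 0 j \<in> carrier_mat 1 1" for j
    using assms by (auto simp: mat_delete_def)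
  \<comment> \<open>Column 0 survives the deletion unless \<open>j = 0\<close>, in which case column
    1 shifts into its place.\<close>
  have minor: "det (mat_delete M 0 j) = M $$ (1, if j = 0 then 1 else 0)" for j
    using assms by (subst det_single[OF del]) (simp add: mat_delete_def)
  have "det M = (\<Sum>j<2. M $$ (0, j) * cofactor M 0 j)"
    by (rule laplace_expansion_row[OF assms]) simp
  then show ?thesis
    using assms by (simp add: cofactor_def minor numeral_2_eq_2)
qed

lemma det_submatrix_single:
  assumes "i < dim_row M" "j < dim_col M"
  shows "det (submatrix M {i} {j}) = M $$ (i, j)"
proof -
  have "{i'. i' < dim_row M \<and> i' \<in> {i}} = {i}" "{j'. j' < dim_col M \<and> j' \<in> {j}} = {j}"
    using assms by auto
  moreover have "pick {k} 0 = k" for k :: nat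
    by (auto intro: Least_equality)
  ultimately show ?thesis
    by (subst det_single) (auto simp: submatrix_def simp del: pick.simps)
qed

lemma det_submatrix_pair:
  assumes "i < i'" "i' < dim_row M" "j < j'" "j' < dim_col M"
  shows "det (submatrix M {i, i'} {j, j'}) =
    M $$ (i, j) * M $$ (i', j') - M $$ (i, j') * M $$ (i', j)"
proof -
  have "{k. k < dim_row M \<and> k \<in> {i, i'}} = {i, i'}" "{k. k < dim_col M \<and> k \<in> {j, j'}} = {j, j'}"
    using assms by auto
  then have sub: "submatrix M {i, i'} {j, j'} =
      mat 2 2 (\<lambda>(k, l). M $$ (pick {i, i'} k, pick {j, j'} l))"
    using assms by (simp only: submatrix_def) (simp add: numeral_2_eq_2 del: pick.simps)
  show ?thesis
    unfolding sub using assms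
    by (subst det_2) (simp_all add: pick_zero_pair pick_one_pair del: pick.simps)
qed

lemma submatrix_full:
  "submatrix M {..<dim_row M} {..<dim_col M} = M"
proof -
  \<comment> \<open>\<open>pick_reduce_set\<close> exchanges the initial segment for
    \<open>UNIV\<close>, on which \<open>pick\<close> is the identity.\<close>
  have "pick {..<n} k = k" if "k < n" for n k
    using that pick_reduce_set[of k n UNIV]
    by (auto simp: pick_UNIV lessThan_def simp del: pick.simps)
  then show ?thesis
    by (intro eq_matI) (auto simp: submatrix_def simp del: pick.simps)
qed

lemma superregular_2I:
  assumes "M \<in> carrier_mat 2 2"
    and ent: "M $$ (0,0) \<noteq> 0" "M $$ (0,1) \<noteq> 0" "M $$ (1,0) \<noteq> 0" "M $$ (1,1) \<noteq> 0" "det M \<noteq> 0"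
  shows "superregular M"
  unfolding superregular_def
proof (intro allI impI, elim conjE)
  fix I J
  assume IJ: "I \<subseteq> {..<dim_row M}" "J \<subseteq> {..<dim_col M}" "card I = card J" "I \<noteq> {}"
  have full: "submatrix M {0, 1} {0, 1} = M"
    using submatrix_full[of M] assms(1) by (simp add: numeral_2_eq_2 lessThan_Suc insert_commute)
  have two: "K = {} \<or> K = {0} \<or> K = {1} \<or> K = {0, 1}" if "K \<subseteq> {..<2}" for K :: "nat set"
    using that by (auto simp: numeral_2_eq_2 lessThan_Suc)
  have "I = {0} \<or> I = {1} \<or> I = {0, 1}" "J = {} \<or> J = {0} \<or> J = {1} \<or> J = {0, 1}"
    using two[of I] two[of J] IJ assms(1) by auto
  \<comment> \<open>Pairs of index sets of different size contradict \<open>card I = card J\<close>;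
    what remains is the four entries and the full determinant.\<close>
  then show "det (submatrix M I J) \<noteq> 0"
    using IJ(3) ent assms(1) full
    by (elim disjE) (simp_all add: det_submatrix_single)
qed

lemma superregular_entry_nonzero:
  assumes "superregular M" "i < dim_row M" "j < dim_col M"
  shows "M $$ (i, j) \<noteq> 0"
  using assms(1)[unfolded superregular_def, rule_format, of "{i}" "{j}"] assms(2,3)
  by (auto simp: det_submatrix_single)

lemma superregular_minor_nonzero:
  assumes "superregular M" "i < i'" "i' < dim_row M" "j < j'" "j' < dim_col M"
  shows "M $$ (i, j) * M $$ (i', j') - M $$ (i, j') * M $$ (i', j) \<noteq> 0"
  using assms(1)[unfolded superregular_def, rule_format, of "{i, i'}" "{j, j'}"] assms(2-)
  by (auto simp: det_submatrix_pair)

lemma superregular_det_nonzero: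
  assumes "superregular M" "M \<in> carrier_mat n n" "n > 0"
  shows "det M \<noteq> 0"
  using assms(1)[unfolded superregular_def, rule_format, of "{..<n}" "{..<n}"] assms(2,3)
    submatrix_full[of M]
  by auto

lemma tilde_carrier:
  "tildeA M \<in> carrier_mat 3 3" "tildeB M \<in> carrier_mat 3 3" "tildeC M \<in> carrier_mat 3 3"
  by (auto simp: tildeA_def tildeB_def tildeC_def mat_of_rows_list_def)

text \<open>The middle row of \<open>tildeB B\<close> is a unit vector with its 1 on the diagonal,
  so Laplace expansion along it leaves a single cofactor, with sign +1, and deleting the middle row
  and column gives back \<open>B\<close>.\<close>

lemma det_tildeB:
  assumes "B \<in> carrier_mat 2 2"
  shows "det (tildeB B) = det B"
proof -
  have minor: "mat_delete (tildeB B) 1 1 = B"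
    using assms
    by (intro eq_matI)
      (auto simp: mat_delete_def tildeB_def mat_of_rows_list_def less_2_cases_iff)
  have "det (tildeB B) = (\<Sum>j<3. tildeB B $$ (1, j) * cofactor (tildeB B) 1 j)"
    by (rule laplace_expansion_row[OF tilde_carrier(2)]) simp
  also have "\<dots> = cofactor (tildeB B) 1 1"
    by (simp add: tildeB_def mat_of_rows_list_def eval_nat_numeral)
  also have "\<dots> = det B"
    by (simp add: cofactor_def minor[simplified])
  finally show ?thesis .
qed

theorem mainTheorem2:
  fixes G A B C :: "'f::{field,finite} mat"
  assumes "G \<in> carrier_mat 3 3"
    and "superregular G"
    and "A \<in> carrier_mat 2 2" and "B \<in> carrier_mat 2 2" and "C \<in> carrier_mat 2 2"
    and "G = tildeC C * tildeB B * tildeA A"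
  shows "superregular A \<and> superregular B \<and> superregular C"
proof -
  let ?a = "\<lambda>i j. A $$ (i, j)" and ?b = "\<lambda>i j. B $$ (i, j)" and ?c = "\<lambda>i j. C $$ (i, j)"
  note defs = tildeA_def tildeB_def tildeC_def mat_of_rows_list_def scalar_prod_def eval_nat_numeral
  have G:
    "G $$ (0,0) = ?b 0 0 * ?a 0 0" "G $$ (0,1) = ?b 0 0 * ?a 0 1" "G $$ (0,2) = ?b 0 1"
    "G $$ (1,0) = ?c 0 0 * ?a 1 0 + ?c 0 1 * ?b 1 0 * ?a 0 0"
    "G $$ (1,1) = ?c 0 0 * ?a 1 1 + ?c 0 1 * ?b 1 0 * ?a 0 1"
    "G $$ (1,2) = ?c 0 1 * ?b 1 1"
    "G $$ (2,0) = ?c 1 0 * ?a 1 0 + ?c 1 1 * ?b 1 0 * ?a 0 0"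
    "G $$ (2,1) = ?c 1 0 * ?a 1 1 + ?c 1 1 * ?b 1 0 * ?a 0 1"
    "G $$ (2,2) = ?c 1 1 * ?b 1 1"
    unfolding assms(6) by (simp_all add: defs algebra_simps)
  have dA: "det A = ?a 0 0 * ?a 1 1 - ?a 0 1 * ?a 1 0"
    and dC: "det C = ?c 0 0 * ?c 1 1 - ?c 0 1 * ?c 1 0"
    using assms(3,5) by (simp_all add: det_2)
  have entry: "G $$ (i, j) \<noteq> 0" if "i < 3" "j < 3" for i j
    using superregular_entry_nonzero[OF assms(2)] assms(1) that by auto
  have minor: "G $$ (i, j) * G $$ (i', j') - G $$ (i, j') * G $$ (i', j) \<noteq> 0"
    if "i < i'" "i' < 3" "j < j'" "j' < 3" for i i' j j'
    using superregular_minor_nonzero[OF assms(2)] assms(1) that by auto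
  \<comment> \<open>Row 0 of \<open>tildeC C\<close> and column 2 of \<open>tildeA A\<close> are
    unit vectors, so row 0 and column 2 of \<open>G\<close> involve only two of the three factors
    and their entries are monomials.\<close>
  have entries: "?a 0 0 \<noteq> 0" "?a 0 1 \<noteq> 0" "?b 0 0 \<noteq> 0" "?b 0 1 \<noteq> 0" "?b 1 1 \<noteq> 0"
    "?c 0 1 \<noteq> 0" "?c 1 1 \<noteq> 0"
    using entry[of 0 0] entry[of 0 1] entry[of 0 2] entry[of 1 2] entry[of 2 2]
    unfolding G by auto
  \<comment> \<open>On columns 0, 1 each row of \<open>G\<close> is a linear combination of the two
    rows of \<open>A\<close>, so a minor there is \<open>det A\<close> times the determinant of the
    coefficients. Rows 1, 2 of \<open>G\<close> are \<open>C\<close> times rows 1, 2 of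
    \<open>tildeB B * tildeA A\<close>; on columns j, 2 the latter form a lower triangular block
    with diagonal \<open>?a 1 j\<close>, \<open>?b 1 1\<close>.\<close>
  have minors:
    "?b 0 0 * ?c 0 0 * det A =
      G $$ (0,0) * G $$ (1,1) - G $$ (0,1) * G $$ (1,0)"
    "?b 0 0 * ?c 1 0 * det A =
      G $$ (0,0) * G $$ (2,1) - G $$ (0,1) * G $$ (2,0)"
    "- det C * ?b 1 0 * det A =
      G $$ (1,0) * G $$ (2,1) - G $$ (1,1) * G $$ (2,0)"
    "det C * ?a 1 0 * ?b 1 1 =
      G $$ (1,0) * G $$ (2,2) - G $$ (1,2) * G $$ (2,0)"
    "det C * ?a 1 1 * ?b 1 1 =
      G $$ (1,1) * G $$ (2,2) - G $$ (1,2) * G $$ (2,1)"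
    unfolding G dA dC by (simp_all add: algebra_simps)
  have "?b 0 0 * ?c 0 0 * det A \<noteq> 0"
    unfolding minors(1) by (rule minor) simp_all
  moreover have "?b 0 0 * ?c 1 0 * det A \<noteq> 0"
    unfolding minors(2) by (rule minor) simp_all
  moreover have "- det C * ?b 1 0 * det A \<noteq> 0"
    unfolding minors(3) by (rule minor) simp_all
  moreover have "det C * ?a 1 0 * ?b 1 1 \<noteq> 0"
    unfolding minors(4) by (rule minor) simp_all
  moreover have "det C * ?a 1 1 * ?b 1 1 \<noteq> 0"
    unfolding minors(5) by (rule minor) simp_all
  \<comment> \<open>\<open>det B\<close> is not a factor of the minors above; it is obtained from
    \<open>det G\<close> by multiplicativity.\<close>
  moreover have "det B \<noteq> 0"
  proof -
    have "det G = det (tildeC C) * det (tildeB B) * det (tildeA A)"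
      unfolding assms(6)
      by (simp add: det_mult[OF mult_carrier_mat[OF tilde_carrier(3,2)] tilde_carrier(1)]
          det_mult[OF tilde_carrier(3,2)])
    then show ?thesis
      using superregular_det_nonzero[OF assms(2,1)] det_tildeB[OF assms(4)] by auto
  qed
  \<comment> \<open>Every factor of a nonzero product is nonzero, which supplies
    \<open>det A\<close>, \<open>det C\<close> and the entries missing from
    \<open>entries\<close>.\<close>
  ultimately show ?thesis
    using entries by (simp add: superregular_2I assms(3-5))
qed

end
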